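(* For all sufficiently small $\varepsilon>0$, the matrix $$B_\varepsilon=\begin{pmatrix}1&-1+\varepsilon&-1+\varepsilon\\-1+\varepsilon&1&1\\-1+\varepsilon&1&1\end{pmatrix}$$ is strictly copositive but not strictly cubically copositive.
   Context: Let $C^3_+=\{c\in\mathbb{R}^3: c_i\ge 0 \text{ for all } i\}$. A symmetric real $3\times3$ matrix $B=(\beta_{ij})_{ij}$ is strictly copositive if $\sum_{i,j=1}^3\beta_{ij}c_ic_j>0$ for all $c\in C^3_+\setminus\{0\}$. It is strictly cubically copositive if there exists $\mu\in C^3_+$ such that $\sum_{i,j=1}^3\beta_{ij}c_j^2c_i\mu_i>0$ for all $c\in C^3_+\setminus\{0\}$. *)

theory Defs
  imports "HOL-Analysis.Analysis"
begin

definition nonneg_cone :: "(real^3) set"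
  where "nonneg_cone = {c. \<forall>i. 0 \<le> c $ i}"

(* The two notions below are intended for symmetric matrices. Symmetry is not part of the
   predicates, so that their negations carry no hidden disjunct; for the matrix of interest
   it is lemma transpose_B_eps. *)

definition strictly_copositive :: "real^3^3 \<Rightarrow> bool"
  where "strictly_copositive B \<longleftrightarrow>
    (\<forall>c \<in> nonneg_cone - {0}. 0 < (\<Sum>i\<in>UNIV. \<Sum>j\<in>UNIV. B $ i $ j * c $ i * c $ j))"

definition strictly_cubically_copositive :: "real^3^3 \<Rightarrow> bool"
  where "strictly_cubically_copositive B \<longleftrightarrow>
    (\<exists>\<mu> \<in> nonneg_cone. \<forall>c \<in> nonneg_cone - {0}.
       0 < (\<Sum>i\<in>UNIV. \<Sum>j\<in>UNIV. B $ i $ j * (c $ j)\<^sup>2 * c $ i * \<mu> $ i))"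

definition B_eps :: "real \<Rightarrow> real^3^3"
  where "B_eps \<epsilon> = vector
    [vector [1, -1 + \<epsilon>, -1 + \<epsilon>],
     vector [-1 + \<epsilon>, 1, 1],
     vector [-1 + \<epsilon>, 1, 1]]"

lemma transpose_B_eps: "transpose (B_eps \<epsilon>) = B_eps \<epsilon>"
  by (simp add: vec_eq_iff forall_3 transpose_def B_eps_def)

end

theory Submission imports Defs begin

text \<open>
  Write \<open>k = 1 - \<epsilon>\<close>. Strict copositivity holds because the quadratic form only sees
  \<open>x = c\<^sub>1\<close> and \<open>s = c\<^sub>2 + c\<^sub>3\<close>: it equals \<open>x\<^sup>2 + s\<^sup>2 - 2 k x s = (x - s)\<^sup>2 + 2 \<epsilon> x s\<close>.

  The cubic form with weights \<open>\<mu> = (p, q, r)\<close> instead sees \<open>c\<^sub>2\<^sup>2 + c\<^sub>3\<^sup>2\<close> together with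
  \<open>q c\<^sub>2 + r c\<^sub>3\<close>, and these pull the weights in opposite directions. In the limit
  \<open>\<epsilon> = 0\<close> it factors as
  \<open>(c\<^sub>2\<^sup>2 + c\<^sub>3\<^sup>2 - c\<^sub>1\<^sup>2) (q c\<^sub>2 + r c\<^sub>3 - p c\<^sub>1)\<close>.
  On the face \<open>c\<^sub>3 = 0\<close> both factors must change sign together, which forces \<open>q\<close> to be
  close to \<open>p\<close>, and likewise \<open>r\<close>. On the ray \<open>c\<^sub>2 = c\<^sub>3 = t c\<^sub>1\<close>, however, the first
  factor changes sign at \<open>t = 1 / sqrt 2\<close> and the second one at \<open>t = p / (q + r)\<close>, which is
  then close to \<open>1/2\<close>; between the two the form is negative. Three points suffice to make this
  quantitative: \<open>(4, 5, 0)\<close> and \<open>(4, 0, 5)\<close> give \<open>q, r > 4 p / 5\<close> at \<open>\<epsilon> = 0\<close>, whereas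
  \<open>(3, 2, 2)\<close> gives \<open>q + r < 3 p / 2\<close>. The gap between \<open>8/5\<close> and \<open>3/2\<close> leaves room for
  every \<open>\<epsilon> < 1/1000\<close>.
\<close>

lemma quadratic_form_B_eps:
  "(\<Sum>i\<in>UNIV. \<Sum>j\<in>UNIV. B_eps \<epsilon> $ i $ j * c $ i * c $ j)
     = (c $ 1 - (c $ 2 + c $ 3))\<^sup>2 + 2 * \<epsilon> * (c $ 1 * (c $ 2 + c $ 3))"
  by (simp add: B_eps_def sum_3 power2_eq_square algebra_simps)

lemma cubic_form_B_eps:
  "(\<Sum>i\<in>UNIV. \<Sum>j\<in>UNIV. B_eps \<epsilon> $ i $ j * (c $ j)\<^sup>2 * c $ i * \<mu> $ i)
     = \<mu> $ 1 * c $ 1 * ((c $ 1)\<^sup>2 - (1 - \<epsilon>) * ((c $ 2)\<^sup>2 + (c $ 3)\<^sup>2))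
       + (\<mu> $ 2 * c $ 2 + \<mu> $ 3 * c $ 3) * ((c $ 2)\<^sup>2 + (c $ 3)\<^sup>2 - (1 - \<epsilon>) * (c $ 1)\<^sup>2)"
  by (simp add: B_eps_def sum_3 algebra_simps)

lemma strictly_copositive_B_eps:
  assumes "0 < \<epsilon>"
  shows "strictly_copositive (B_eps \<epsilon>)"
  unfolding strictly_copositive_def quadratic_form_B_eps
proof
  fix c :: "real^3"
  assume c: "c \<in> nonneg_cone - {0}"
  then have nonneg: "0 \<le> c $ 1" "0 \<le> c $ 2" "0 \<le> c $ 3"
    by (auto simp: nonneg_cone_def)
  have nonzero: "\<not> (c $ 1 = 0 \<and> c $ 2 = 0 \<and> c $ 3 = 0)"
    using c by (auto simp: vec_eq_iff forall_3)
  show "0 < (c $ 1 - (c $ 2 + c $ 3))\<^sup>2 + 2 * \<epsilon> * (c $ 1 * (c $ 2 + c $ 3))"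
  proof (cases "c $ 1 = c $ 2 + c $ 3")
    case True
    \<comment> \<open>The square vanishes, but then neither factor of the mixed term does.\<close>
    then have "0 < c $ 1" using nonneg nonzero by linarith
    then show ?thesis using True assms by simp
  next
    case False
    then have "0 < (c $ 1 - (c $ 2 + c $ 3))\<^sup>2" by simp
    moreover have "0 \<le> 2 * \<epsilon> * (c $ 1 * (c $ 2 + c $ 3))" using nonneg assms by simp
    ultimately show ?thesis by linarith
  qed
qed

lemma not_strictly_cubically_copositive_B_eps:
  assumes eps: "0 < \<epsilon>" "\<epsilon> < 1/1000"
  shows "\<not> strictly_cubically_copositive (B_eps \<epsilon>)"
proof
  assume "strictly_cubically_copositive (B_eps \<epsilon>)"
  then obtain \<mu> where \<mu>: "\<mu> \<in> nonneg_cone"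
    and pos: "\<And>c. c \<in> nonneg_cone - {0} \<Longrightarrow>
      0 < \<mu> $ 1 * c $ 1 * ((c $ 1)\<^sup>2 - (1 - \<epsilon>) * ((c $ 2)\<^sup>2 + (c $ 3)\<^sup>2))
        + (\<mu> $ 2 * c $ 2 + \<mu> $ 3 * c $ 3) * ((c $ 2)\<^sup>2 + (c $ 3)\<^sup>2 - (1 - \<epsilon>) * (c $ 1)\<^sup>2)"
    unfolding strictly_cubically_copositive_def cubic_form_B_eps by blast
  define p q r where "p = \<mu> $ 1" and "q = \<mu> $ 2" and "r = \<mu> $ 3"
  have nonneg: "0 \<le> p" "0 \<le> q" "0 \<le> r"
    using \<mu> by (auto simp: nonneg_cone_def p_def q_def r_def)
  have pos_at: "0 < p * x * (x\<^sup>2 - (1 - \<epsilon>) * (y\<^sup>2 + z\<^sup>2))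
      + (q * y + r * z) * (y\<^sup>2 + z\<^sup>2 - (1 - \<epsilon>) * x\<^sup>2)"
    if "0 < x" "0 \<le> y" "0 \<le> z" for x y z
  proof -
    have "vector [x, y, z] \<in> nonneg_cone - {0 :: real^3}"
      using that by (auto simp: nonneg_cone_def forall_3 vec_eq_iff)
    from pos[OF this] show ?thesis by (simp add: p_def q_def r_def)
  qed
  \<comment> \<open>The contributions of \<open>\<epsilon>\<close> are controlled by treating its products with the weights
      as separate small quantities; the contradiction is then linear.\<close>
  have small: "0 \<le> p * \<epsilon>" "0 \<le> q * \<epsilon>" "0 \<le> r * \<epsilon>"
      "p * \<epsilon> \<le> p / 1000" "q * \<epsilon> \<le> q / 1000" "r * \<epsilon> \<le> r / 1000"
    using nonneg eps mult_left_mono[of \<epsilon> "1/1000"] by auto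
  have "36 * p < 45 * q + 100 * (p * \<epsilon>) + 80 * (q * \<epsilon>)"
    using pos_at[of 4 5 0] by (simp add: algebra_simps)
  moreover have "36 * p < 45 * r + 100 * (p * \<epsilon>) + 80 * (r * \<epsilon>)"
    using pos_at[of 4 0 5] by (simp add: algebra_simps)
  moreover have "2 * q + 2 * r < 3 * p + 24 * (p * \<epsilon>) + 18 * (q * \<epsilon>) + 18 * (r * \<epsilon>)"
    using pos_at[of 3 2 2] by (simp add: algebra_simps)
  ultimately show False using nonneg small by linarith
qed

theorem mainTheorem9:
  "\<exists>\<epsilon>0 > (0::real). \<forall>\<epsilon>. 0 < \<epsilon> \<and> \<epsilon> < \<epsilon>0 \<longrightarrow>
     strictly_copositive (B_eps \<epsilon>) \<and> \<not> strictly_cubically_copositive (B_eps \<epsilon>)"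
proof (intro exI conjI allI impI)
  show "(0::real) < 1/1000" by simp
qed (auto intro: strictly_copositive_B_eps dest: not_strictly_cubically_copositive_B_eps)

end
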